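(* Let $C$ be a category with finite products and finite coproducts, and let $U:C\to\mathbf{Set}$ be a functor preserving them, with natural isomorphisms $$U(X+Y)\cong U(X)+U(Y),\qquad U(X\times Y)\cong U(X)\times U(Y).$$ Let $\Sigma$ be a signature, let $X\in C$, and for each operator $\sigma$ of $\Sigma$, of arity $|\sigma|$, let $c_\sigma:X^{|\sigma|}\to X$ be a morphism in $C$. Let $(U(X),c)$ be the $\Sigma$-algebra whose operations are the maps $U(c_\sigma):U(X)^{|\sigma|}\cong U(X^{|\sigma|})\to U(X)$. Then every rewriting model over $\Sigma$ with $\Sigma$-algebra $(U(X),c)$, given by a $\Sigma$-identity $(l,r)$, is equivalent to a cartesian dynamical system whose sets and maps are all in $C$: there exist $d\in\mathbb{N}$, morphisms $G:X^d\to X^d$ and $f:X^d\to X$ in $C$, and an element $x_0\in U(X^d)\cong U(X)^d$ such that the sequence $\mathbb{N}\to U(X)$ generated by the rewriting model is $n\mapsto U(f)\big(U(G)^n(x_0)\big)$.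
   Context: Dynamical systems. A dynamical system is a pair of sets $(X,Y)$ with maps $G:Y\to Y$ and $f:Y\to X$; it is cartesian if $Y=X^d$ for some $d\in\mathbb{N}$. From an initial state $y_0\in Y$ it generates the sequence $n\mapsto f(G^n(y_0))$ in $X$. Two models are equivalent when they generate the same sequence. Terms. A signature $\Sigma$ assigns to each $n\in\mathbb{N}$ a set $\Sigma_n$ of $n$-ary operators. For a set $V$ of variables disjoint from $\Sigma$, $T(V)=T(\Sigma,V)$ is the set of $\Sigma$-terms over $V$: the smallest set containing $V$ and containing $f(t_1,\dots,t_n)$ for all $f\in\Sigma_n$ and $t_i\in T(V)$. Ground terms are the elements of $T=T(\Sigma,\varnothing)$. The set $Pos(s)$ of positions of a term $s$ is a set of finite strings of positive integers: $Pos(v)=\{\epsilon\}$ (the empty string) for $v\in V$, and $Pos(f(s_1,\dots,s_n))=\{\epsilon\}\cup\bigcup_i\{ip: p\in Pos(s_i)\}$. The subterm $s|_p$ at $p\in Pos(s)$ is given by $s|_\epsilon=s$, $f(s_1,\dots,s_n)|_{iq}=s_i|_q$. The term $s[t]_p$ obtained by replacing the subterm at $p$ by $t$ is given by $s[t]_\epsilon=t$, $f(s_1,\dots,s_n)[t]_{iq}=f(s_1,\dots,s_i[t]_q,\dots,s_n)$. $Var(s)$ is the set of variables occurring in $s$. A substitution is a map $\sigma:V\to T(V)$, extended to $T(V)\to T(V)$ by $\sigma(f(s_1,\dots,s_n))=f(\sigma(s_1),\dots,\sigma(s_n))$. A $\Sigma$-identity is a pair $(l,r)$ of terms in $T(V)$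 with $Var(r)\subseteq Var(l)$. Rewriting functions. For a term $s$ and position $p$, $T_p^s=\{t\in T(V): p\in Pos(t),\ t|_p=\sigma(s)\text{ for some substitution }\sigma\}$. For a $\Sigma$-identity $(l,r)$ the rewriting function $R_p:T_p^l\to T_p^r$ sends $t$ with $t|_p=\sigma(l)$ to $t[\sigma(r)]_p$ (independent of the choice of $\sigma$). If $r=\tau(l)$ for a substitution $\tau$, then $T_p^r\subseteq T_p^l$, so $R_p$ can be iterated. Ground terms are preserved by $R_p$. Algebras. A $\Sigma$-algebra $(A,c)$ is a set $A$ with a function $c_\sigma:A^n\to A$ for each $\sigma\in\Sigma_n$ and each $n$. The catamorphism $\mathrm{cata}(c):T\to A$ is the unique $\Sigma$-algebra homomorphism from the ground terms, i.e. $\mathrm{cata}(c)(\sigma(t_1,\dots,t_n))=c_\sigma(\mathrm{cata}(c)(t_1),\dots,\mathrm{cata}(c)(t_n))$. Rewriting models. A rewriting model with $\Sigma$-algebra $(A,c)$ is given by a variable set $V$, a $\Sigma$-identity $(l,r)$ in $T(V)$ with $r=\tau(l)$ for some substitution $\tau$, a position $p$, and a ground initial term $t_0\in T_p^l$. It generates the sequence $\mathbb{N}\to A$, $n\mapsto \mathrm{cata}(c)(R_p^n(t_0))$. Conventions. $X^0$ denotes the terminal object. That $U$ preserves finite products and coproducts means that the displayed isomorphisms are the canonical comparison maps, and that the empty cases are included. *)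

theory Defs
  imports Main "HOL-Library.FuncSet"
begin

section \<open>Terms\<close>

text \<open>
  A signature is a function \<open>Sig :: nat \<Rightarrow> 'f set\<close>, where \<open>Sig n\<close> is the set of
  \<open>n\<close>-ary operators. The sets \<open>Sig n\<close> need not be disjoint: an occurrence of an operator in a
  term is identified by its name together with its number of arguments. The datatype contains raw
  terms; \<open>terms Sig V\<close> is the set of terms over the signature and the variable set \<open>V\<close>.
\<close>

datatype (dead 'f, vars: 'v) trm = Var 'v | Fun 'f "('f, 'v) trm list"

inductive_set terms :: "(nat \<Rightarrow> 'f set) \<Rightarrow> 'v set \<Rightarrow> ('f, 'v) trm set"
  for Sig :: "nat \<Rightarrow> 'f set" and V :: "'v set" where
  Var: "v \<in> V \<Longrightarrow> Var v \<in> terms Sig V"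
| Fun: "f \<in> Sig (length ts) \<Longrightarrow> (\<And>t. t \<in> set ts \<Longrightarrow> t \<in> terms Sig V) \<Longrightarrow> Fun f ts \<in> terms Sig V"

abbreviation ground_terms :: "(nat \<Rightarrow> 'f set) \<Rightarrow> ('f, 'v) trm set" where
  "ground_terms Sig \<equiv> terms Sig {}"

lemma size_nth_less [termination_simp]:
  "i < length ts \<Longrightarrow> size (ts ! i) < Suc (size_list size ts)"
  by (simp add: less_Suc_eq_le size_list_estimation' [OF nth_mem])

text \<open>Positions are strings of positive integers; list indexing starts at 0, hence the shifts.\<close>

fun positions :: "('f, 'v) trm \<Rightarrow> nat list set" where
  "positions (Var v) = {[]}"
| "positions (Fun f ts) = {[]} \<union> (\<Union>i\<in>{..<length ts}. (#) (Suc i) ` positions (ts ! i))"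

fun subterm_at :: "('f, 'v) trm \<Rightarrow> nat list \<Rightarrow> ('f, 'v) trm" where
  "subterm_at s [] = s"
| "subterm_at (Fun f ts) (i # q) = subterm_at (ts ! (i - 1)) q"
| "subterm_at (Var v) (i # q) = undefined"

fun replace_at :: "('f, 'v) trm \<Rightarrow> nat list \<Rightarrow> ('f, 'v) trm \<Rightarrow> ('f, 'v) trm" where
  "replace_at s [] t = t"
| "replace_at (Fun f ts) (i # q) t = Fun f (ts[i - 1 := replace_at (ts ! (i - 1)) q t])"
| "replace_at (Var v) (i # q) t = undefined"

text \<open>Only the values of a substitution on \<open>V\<close> are relevant.\<close>

definition substitutions :: "(nat \<Rightarrow> 'f set) \<Rightarrow> 'v set \<Rightarrow> ('v \<Rightarrow> ('f, 'v) trm) set" where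
  "substitutions Sig V = V \<rightarrow> terms Sig V"

primrec subst :: "('v \<Rightarrow> ('f, 'v) trm) \<Rightarrow> ('f, 'v) trm \<Rightarrow> ('f, 'v) trm" where
  "subst \<sigma> (Var v) = \<sigma> v"
| "subst \<sigma> (Fun f ts) = Fun f (map (subst \<sigma>) ts)"

definition sig_identity :: "(nat \<Rightarrow> 'f set) \<Rightarrow> 'v set \<Rightarrow> ('f, 'v) trm \<Rightarrow> ('f, 'v) trm \<Rightarrow> bool" where
  "sig_identity Sig V l r \<longleftrightarrow> l \<in> terms Sig V \<and> r \<in> terms Sig V \<and> vars r \<subseteq> vars l"


section \<open>Rewriting functions and rewriting models\<close>

definition instances_at ::
    "(nat \<Rightarrow> 'f set) \<Rightarrow> 'v set \<Rightarrow> nat list \<Rightarrow> ('f, 'v) trm \<Rightarrow> ('f, 'v) trm set" where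
  "instances_at Sig V p s =
     {t \<in> terms Sig V. p \<in> positions t \<and> (\<exists>\<sigma>\<in>substitutions Sig V. subterm_at t p = subst \<sigma> s)}"

text \<open>The rewriting function is meaningful on \<open>instances_at Sig V p l\<close>; there its value does not
  depend on the matching substitution, see \<open>rewrite_eq\<close>.\<close>

definition rewrite ::
    "(nat \<Rightarrow> 'f set) \<Rightarrow> 'v set \<Rightarrow> ('f, 'v) trm \<Rightarrow> ('f, 'v) trm \<Rightarrow> nat list
      \<Rightarrow> ('f, 'v) trm \<Rightarrow> ('f, 'v) trm" where
  "rewrite Sig V l r p t =
     (THE u. \<exists>\<sigma>\<in>substitutions Sig V. subterm_at t p = subst \<sigma> l \<and> u = replace_at t p (subst \<sigma> r))"

lemma subst_eq_iff: "subst \<sigma> t = subst \<rho> t \<longleftrightarrow> (\<forall>v\<in>vars t. \<sigma> v = \<rho> v)"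
  by (induction t) auto

lemma rewrite_eq:
  assumes "sig_identity Sig V l r" "\<sigma> \<in> substitutions Sig V" "subterm_at t p = subst \<sigma> l"
  shows "rewrite Sig V l r p t = replace_at t p (subst \<sigma> r)"
  unfolding rewrite_def
proof (rule the_equality)
  fix u
  assume "\<exists>\<rho>\<in>substitutions Sig V. subterm_at t p = subst \<rho> l \<and> u = replace_at t p (subst \<rho> r)"
  then obtain \<rho> where \<rho>: "subst \<sigma> l = subst \<rho> l" "u = replace_at t p (subst \<rho> r)"
    using assms(3) by auto
  then have "subst \<sigma> r = subst \<rho> r"
    using assms(1) unfolding sig_identity_def subst_eq_iff by blast
  with \<rho> show "u = replace_at t p (subst \<sigma> r)" by simp
qed (use assms in blast)

text \<open>The operations of an algebra with carrier \<open>A\<close> are indexed by arity and operator;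
  \<open>A\<^sup>n\<close> consists of the lists over \<open>A\<close> of length \<open>n\<close>.
  Only the values of \<open>cata\<close> on ground terms are relevant.\<close>

primrec cata :: "(nat \<Rightarrow> 'f \<Rightarrow> 'a list \<Rightarrow> 'a) \<Rightarrow> ('f, 'v) trm \<Rightarrow> 'a" where
  "cata c (Var v) = undefined"
| "cata c (Fun f ts) = c (length ts) f (map (cata c) ts)"

definition rewriting_model ::
    "(nat \<Rightarrow> 'f set) \<Rightarrow> 'v set \<Rightarrow> ('f, 'v) trm \<Rightarrow> ('f, 'v) trm \<Rightarrow> nat list
      \<Rightarrow> ('f, 'v) trm \<Rightarrow> bool" where
  "rewriting_model Sig V l r p t0 \<longleftrightarrow>
     sig_identity Sig V l r \<and> (\<exists>\<tau>\<in>substitutions Sig V. r = subst \<tau> l) \<and>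
     t0 \<in> ground_terms Sig \<and> t0 \<in> instances_at Sig V p l"

definition rewriting_sequence ::
    "(nat \<Rightarrow> 'f set) \<Rightarrow> (nat \<Rightarrow> 'f \<Rightarrow> 'a list \<Rightarrow> 'a) \<Rightarrow> 'v set \<Rightarrow> ('f, 'v) trm \<Rightarrow> ('f, 'v) trm
      \<Rightarrow> nat list \<Rightarrow> ('f, 'v) trm \<Rightarrow> nat \<Rightarrow> 'a" where
  "rewriting_sequence Sig c V l r p t0 n = cata c ((rewrite Sig V l r p ^^ n) t0)"

definition dynamical_sequence :: "('y \<Rightarrow> 'y) \<Rightarrow> ('y \<Rightarrow> 'x) \<Rightarrow> 'y \<Rightarrow> nat \<Rightarrow> 'x" where
  "dynamical_sequence G f y0 n = f ((G ^^ n) y0)"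


section \<open>Categories with finite products and coproducts\<close>

record ('o, 'm) cat =
  Obj :: "'o set"
  Arr :: "'m set"
  Dom :: "'m \<Rightarrow> 'o"
  Cod :: "'m \<Rightarrow> 'o"
  Id :: "'o \<Rightarrow> 'm"
  Comp :: "'m \<Rightarrow> 'm \<Rightarrow> 'm"

definition Hom :: "('o, 'm) cat \<Rightarrow> 'o \<Rightarrow> 'o \<Rightarrow> 'm set" where
  "Hom C A B = {f \<in> Arr C. Dom C f = A \<and> Cod C f = B}"

text \<open>\<open>Comp C g f\<close> is the composite "g after f".\<close>

locale category =
  fixes C :: "('o, 'm) cat"
  assumes dom_obj: "f \<in> Arr C \<Longrightarrow> Dom C f \<in> Obj C"
    and cod_obj: "f \<in> Arr C \<Longrightarrow> Cod C f \<in> Obj C"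
    and id_hom: "A \<in> Obj C \<Longrightarrow> Id C A \<in> Hom C A A"
    and comp_hom: "f \<in> Hom C A B \<Longrightarrow> g \<in> Hom C B D \<Longrightarrow> Comp C g f \<in> Hom C A D"
    and comp_id_right: "f \<in> Hom C A B \<Longrightarrow> Comp C f (Id C A) = f"
    and comp_id_left: "f \<in> Hom C A B \<Longrightarrow> Comp C (Id C B) f = f"
    and comp_assoc: "f \<in> Hom C A B \<Longrightarrow> g \<in> Hom C B D \<Longrightarrow> h \<in> Hom C D E \<Longrightarrow>
      Comp C h (Comp C g f) = Comp C (Comp C h g) f"

definition terminal_object :: "('o, 'm) cat \<Rightarrow> 'o \<Rightarrow> bool" where
  "terminal_object C T \<longleftrightarrow> T \<in> Obj C \<and> (\<forall>A\<in>Obj C. \<exists>!f. f \<in> Hom C A T)"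

definition initial_object :: "('o, 'm) cat \<Rightarrow> 'o \<Rightarrow> bool" where
  "initial_object C I \<longleftrightarrow> I \<in> Obj C \<and> (\<forall>A\<in>Obj C. \<exists>!f. f \<in> Hom C I A)"

definition is_product :: "('o, 'm) cat \<Rightarrow> 'o \<Rightarrow> 'o \<Rightarrow> 'o \<Rightarrow> 'm \<Rightarrow> 'm \<Rightarrow> bool" where
  "is_product C A B P p q \<longleftrightarrow>
     P \<in> Obj C \<and> p \<in> Hom C P A \<and> q \<in> Hom C P B \<and>
     (\<forall>D\<in>Obj C. \<forall>f\<in>Hom C D A. \<forall>g\<in>Hom C D B.
        \<exists>!h. h \<in> Hom C D P \<and> Comp C p h = f \<and> Comp C q h = g)"

definition is_coproduct :: "('o, 'm) cat \<Rightarrow> 'o \<Rightarrow> 'o \<Rightarrow> 'o \<Rightarrow> 'm \<Rightarrow> 'm \<Rightarrow> bool" where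
  "is_coproduct C A B S i j \<longleftrightarrow>
     S \<in> Obj C \<and> i \<in> Hom C A S \<and> j \<in> Hom C B S \<and>
     (\<forall>D\<in>Obj C. \<forall>f\<in>Hom C A D. \<forall>g\<in>Hom C B D.
        \<exists>!h. h \<in> Hom C S D \<and> Comp C h i = f \<and> Comp C h j = g)"

definition has_finite_products :: "('o, 'm) cat \<Rightarrow> bool" where
  "has_finite_products C \<longleftrightarrow>
     (\<exists>T. terminal_object C T) \<and> (\<forall>A\<in>Obj C. \<forall>B\<in>Obj C. \<exists>P p q. is_product C A B P p q)"

definition has_finite_coproducts :: "('o, 'm) cat \<Rightarrow> bool" where
  "has_finite_coproducts C \<longleftrightarrow>
     (\<exists>I. initial_object C I) \<and> (\<forall>A\<in>Obj C. \<forall>B\<in>Obj C. \<exists>S i j. is_coproduct C A B S i j)"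

text \<open>\<open>is_power C X n P \<pi>\<close>: the object \<open>P\<close> with the projections \<open>\<pi> 0, \<dots>, \<pi> (n - 1)\<close> is a
  product of \<open>n\<close> copies of \<open>X\<close>. For \<open>n = 0\<close> this says that \<open>P\<close> is terminal.\<close>

definition is_power :: "('o, 'm) cat \<Rightarrow> 'o \<Rightarrow> nat \<Rightarrow> 'o \<Rightarrow> (nat \<Rightarrow> 'm) \<Rightarrow> bool" where
  "is_power C X n P \<pi> \<longleftrightarrow>
     P \<in> Obj C \<and> (\<forall>i<n. \<pi> i \<in> Hom C P X) \<and>
     (\<forall>D\<in>Obj C. \<forall>f. (\<forall>i<n. f i \<in> Hom C D X) \<longrightarrow>
        (\<exists>!h. h \<in> Hom C D P \<and> (\<forall>i<n. Comp C (\<pi> i) h = f i)))"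


section \<open>Set-valued functors\<close>

text \<open>The sets are subsets of an arbitrary type \<open>'u\<close>, and \<open>UArr U f\<close> is regarded as a map on the
  carrier \<open>UObj U (Dom C f)\<close> only, so that all equations are required only there.\<close>

record ('o, 'm, 'u) setfun =
  UObj :: "'o \<Rightarrow> 'u set"
  UArr :: "'m \<Rightarrow> 'u \<Rightarrow> 'u"

locale set_functor = category C
  for C :: "('o, 'm) cat" +
  fixes U :: "('o, 'm, 'u) setfun"
  assumes map_arr: "f \<in> Hom C A B \<Longrightarrow> UArr U f \<in> UObj U A \<rightarrow> UObj U B"
    and map_id: "A \<in> Obj C \<Longrightarrow> x \<in> UObj U A \<Longrightarrow> UArr U (Id C A) x = x"
    and map_comp: "f \<in> Hom C A B \<Longrightarrow> g \<in> Hom C B D \<Longrightarrow> x \<in> UObj U A \<Longrightarrow>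
      UArr U (Comp C g f) x = UArr U g (UArr U f x)"

text \<open>Preservation means that the canonical comparison maps
  \<open>U(A \<times> B) \<rightarrow> U(A) \<times> U(B)\<close>, \<open>U(1) \<rightarrow> 1\<close>, \<open>U(A) + U(B) \<rightarrow> U(A + B)\<close> and \<open>\<emptyset> \<rightarrow> U(0)\<close> are bijective.\<close>

definition preserves_finite_products ::
    "('o, 'm) cat \<Rightarrow> ('o, 'm, 'u) setfun \<Rightarrow> bool" where
  "preserves_finite_products C U \<longleftrightarrow>
     (\<forall>T. terminal_object C T \<longrightarrow> (\<exists>!x. x \<in> UObj U T)) \<and>
     (\<forall>A\<in>Obj C. \<forall>B\<in>Obj C. \<forall>P p q. is_product C A B P p q \<longrightarrow>
        bij_betw (\<lambda>z. (UArr U p z, UArr U q z)) (UObj U P) (UObj U A \<times> UObj U B))"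

definition preserves_finite_coproducts ::
    "('o, 'm) cat \<Rightarrow> ('o, 'm, 'u) setfun \<Rightarrow> bool" where
  "preserves_finite_coproducts C U \<longleftrightarrow>
     (\<forall>I. initial_object C I \<longrightarrow> UObj U I = {}) \<and>
     (\<forall>A\<in>Obj C. \<forall>B\<in>Obj C. \<forall>S i j. is_coproduct C A B S i j \<longrightarrow>
        bij_betw (case_sum (UArr U i) (UArr U j)) (UObj U A <+> UObj U B) (UObj U S))"

text \<open>The canonical map \<open>U(X\<^sup>n) \<rightarrow> U(X)\<^sup>n\<close> for a power with projections \<open>\<pi>\<close>.\<close>

definition power_comparison ::
    "('o, 'm, 'u) setfun \<Rightarrow> nat \<Rightarrow> (nat \<Rightarrow> 'm) \<Rightarrow> 'u \<Rightarrow> 'u list" where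
  "power_comparison U n \<pi> z = map (\<lambda>i. UArr U (\<pi> i) z) [0..<n]"

text \<open>For powers \<open>Xp n\<close> of an object with projections \<open>pr n\<close> and arrows \<open>c n s\<close> from \<open>Xp n\<close> to that
  object: the operations \<open>U(X)\<^sup>n \<cong> U(X\<^sup>n) \<rightarrow> U(X)\<close>.\<close>

definition induced_operations ::
    "('o, 'm, 'u) setfun \<Rightarrow> (nat \<Rightarrow> 'o) \<Rightarrow> (nat \<Rightarrow> nat \<Rightarrow> 'm) \<Rightarrow> (nat \<Rightarrow> 'f \<Rightarrow> 'm)
      \<Rightarrow> nat \<Rightarrow> 'f \<Rightarrow> 'u list \<Rightarrow> 'u" where
  "induced_operations U Xp pr c n s xs =
     UArr U (c n s) (the_inv_into (UObj U (Xp n)) (power_comparison U n (pr n)) xs)"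

end

theory Submission
  imports Defs
begin

text \<open>
  Write \<open>r = \<tau>(l)\<close> and let \<open>\<sigma>\<close> match \<open>l\<close> with the subterm of \<open>t\<^sub>0\<close> at \<open>p\<close>. A rewriting step leaves the
  context \<open>t\<^sub>0[_]\<^sub>p\<close> alone and replaces the matching substitution \<open>\<sigma>\<close> by \<open>\<sigma> \<circ> \<tau>\<close>, so the \<open>n\<close>-th term is
  \<open>\<sigma>\<^sub>n(t\<^sub>0[l]\<^sub>p)\<close> with \<open>\<sigma>\<^sub>n = \<sigma> \<circ> \<tau>\<^sup>n\<close> (lemma \<open>rewrite_iterate\<close>). Hence all that evolves is the tuple of values of
  \<open>\<sigma>\<^sub>n(v)\<close>, where \<open>v\<close> ranges over the finitely many variables of \<open>l\<close>; let \<open>d\<close> be their number. Since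
  \<open>Var(\<tau>(l)) = Var(r) \<subseteq> Var(l)\<close>, each \<open>\<tau>(v)\<close> is a term in the same \<open>d\<close> variables.

  A term in \<open>d\<close> variables is interpreted by an arrow \<open>X\<^sup>d \<rightarrow> X\<close>, built from projections, tuplings
  and the arrows \<open>c\<^sub>\<sigma>\<close>, and \<open>U\<close> takes this arrow to the evaluation of the term in the algebra
  \<open>U(X)\<close> (lemma \<open>map_term_arrow\<close>). The arrow \<open>G\<close> is the tuple of the interpretations of the \<open>\<tau>(v)\<close>,
  and \<open>f\<close> is the interpretation of \<open>t\<^sub>0[l]\<^sub>p\<close>.

  On the categorical side the one fact to establish is that \<open>U(X\<^sup>n) \<rightarrow> U(X)\<^sup>n\<close> is bijective for all
  \<open>n\<close> (lemma \<open>comparison_bij\<close>). It follows from the binary case by induction, as \<open>X\<^sup>n\<^sup>+\<^sup>1\<close> is a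
  product of \<open>X\<^sup>n\<close> and \<open>X\<close>. Injectivity identifies the induced operations, and surjectivity provides
  the initial state.
\<close>

section \<open>Terms, substitutions and contexts\<close>

lemma finite_vars: "finite (vars t)"
  by (induction t) auto

lemma terms_iff_vars:
  "t \<in> terms Sig W \<longleftrightarrow> t \<in> terms Sig UNIV \<and> vars t \<subseteq> W"
proof
  show "t \<in> terms Sig W \<Longrightarrow> t \<in> terms Sig UNIV \<and> vars t \<subseteq> W"
    by (induction rule: terms.induct) (auto intro: terms.intros)
next
  have "t \<in> terms Sig UNIV \<Longrightarrow> vars t \<subseteq> W \<Longrightarrow> t \<in> terms Sig W"
    by (induction rule: terms.induct) (auto intro!: terms.intros)
  then show "t \<in> terms Sig UNIV \<and> vars t \<subseteq> W \<Longrightarrow> t \<in> terms Sig W" by blast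
qed

lemma terms_restrict_vars:
  "t \<in> terms Sig V \<Longrightarrow> vars t \<subseteq> W \<Longrightarrow> t \<in> terms Sig W"
  using terms_iff_vars by blast

lemma subst_subst: "subst \<sigma> (subst \<tau> t) = subst (\<lambda>v. subst \<sigma> (\<tau> v)) t"
  by (induction t) auto

lemma vars_subst: "vars (subst \<tau> t) = (\<Union>v\<in>vars t. vars (\<tau> v))"
  by (induction t) auto

lemma subst_terms:
  "t \<in> terms Sig V \<Longrightarrow> \<sigma> \<in> V \<rightarrow> terms Sig W \<Longrightarrow> subst \<sigma> t \<in> terms Sig W"
  by (induction rule: terms.induct) (auto intro!: terms.intros)

lemma subst_ground: "vars t = {} \<Longrightarrow> subst \<sigma> t = t"
  by (induction t) (auto intro: map_idI)

lemma subterm_at_replace_at: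
  "p \<in> positions t \<Longrightarrow> subterm_at (replace_at t p u) p = u"
  by (induction t p u rule: replace_at.induct) auto

lemma replace_at_replace_at:
  "p \<in> positions t \<Longrightarrow> replace_at (replace_at t p u) p w = replace_at t p w"
  by (induction t p u rule: replace_at.induct) auto

lemma replace_at_subterm_at:
  "p \<in> positions t \<Longrightarrow> replace_at t p (subterm_at t p) = t"
  by (induction t p rule: subterm_at.induct) auto

lemma vars_subterm_at:
  "p \<in> positions t \<Longrightarrow> vars (subterm_at t p) \<subseteq> vars t"
  by (induction t p rule: subterm_at.induct) fastforce+

lemma replace_at_terms:
  "p \<in> positions t \<Longrightarrow> t \<in> terms Sig V \<Longrightarrow> u \<in> terms Sig V \<Longrightarrow> replace_at t p u \<in> terms Sig V"
proof (induction t p u rule: replace_at.induct)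
  case (2 f ts i q u)
  from "2.prems"(2) have f: "f \<in> Sig (length ts)" and ts: "set ts \<subseteq> terms Sig V"
    by (auto elim: terms.cases)
  have "replace_at (ts ! (i - 1)) q u \<in> terms Sig V"
  proof (rule "2.IH")
    show "q \<in> positions (ts ! (i - 1))" and "ts ! (i - 1) \<in> terms Sig V"
      using "2.prems"(1) ts by (auto intro: subsetD nth_mem)
  qed (use "2.prems"(3) in simp)
  then have "set (ts[i - 1 := replace_at (ts ! (i - 1)) q u]) \<subseteq> terms Sig V"
    using ts set_update_subset_insert[of ts "i - 1"] by fast
  with f show ?case by (auto intro!: terms.intros)
qed auto

lemma subst_replace_at_ground:
  "p \<in> positions t \<Longrightarrow> vars t = {} \<Longrightarrow> subst \<sigma> (replace_at t p u) = replace_at t p (subst \<sigma> u)"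
proof (induction t p u rule: replace_at.induct)
  case (2 f ts i q u)
  have "map (subst \<sigma>) ts = ts"
    using "2.prems"(2) by (auto intro!: map_idI subst_ground)
  with 2 show ?case by (auto simp: map_update)
qed auto

text \<open>
  Rewriting at a fixed position by \<open>l \<rightarrow> \<tau>(l)\<close> only changes the substitution: the new subterm
  \<open>\<sigma>(\<tau>(l))\<close> is the instance of \<open>l\<close> under \<open>\<sigma> \<circ> \<tau>\<close>.
\<close>

lemma rewrite_iterate:
  assumes "sig_identity Sig V l (subst \<tau> l)" and \<tau>: "\<tau> \<in> substitutions Sig V"
    and \<sigma>: "\<sigma> \<in> substitutions Sig V"
    and p: "p \<in> positions t" and t: "subterm_at t p = subst \<sigma> l"
  defines "\<sigma>s \<equiv> \<lambda>n. ((\<lambda>\<rho> v. subst \<rho> (\<tau> v)) ^^ n) \<sigma>"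
  shows "(rewrite Sig V l (subst \<tau> l) p ^^ n) t = replace_at t p (subst (\<sigma>s n) l)"
proof (induction n)
  case 0
  show ?case using replace_at_subterm_at[OF p] t by (simp add: \<sigma>s_def)
next
  case (Suc n)
  have "\<sigma>s n \<in> substitutions Sig V"
  proof (induction n)
    case 0
    show ?case using \<sigma> by (simp add: \<sigma>s_def)
  next
    case (Suc n)
    then show ?case using \<tau> by (auto simp: \<sigma>s_def substitutions_def intro: subst_terms)
  qed
  then have "rewrite Sig V l (subst \<tau> l) p (replace_at t p (subst (\<sigma>s n) l))
      = replace_at t p (subst (\<sigma>s n) (subst \<tau> l))"
    using assms(1) by (simp add: rewrite_eq subterm_at_replace_at p replace_at_replace_at)
  with Suc show ?case by (simp add: \<sigma>s_def subst_subst)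
qed


section \<open>Powers and their comparison maps\<close>

locale product_preserving_functor_with_powers = set_functor C U
  for C :: "('o, 'm) cat" and U :: "('o, 'm, 'u) setfun" +
  fixes X :: 'o and Xp :: "nat \<Rightarrow> 'o" and pr :: "nat \<Rightarrow> nat \<Rightarrow> 'm"
  assumes X_obj: "X \<in> Obj C"
    and power: "is_power C X n (Xp n) (pr n)"
    and preserves: "preserves_finite_products C U"
begin

lemma power_obj: "Xp n \<in> Obj C"
  using power[of n] by (simp add: is_power_def)

lemma pr_hom: "i < n \<Longrightarrow> pr n i \<in> Hom C (Xp n) X"
  using power[of n] by (simp add: is_power_def)

lemma hom_dom_obj: "f \<in> Hom C A B \<Longrightarrow> A \<in> Obj C"
  using dom_obj by (auto simp: Hom_def)

lemma power_universal:
  assumes "D \<in> Obj C" and "\<And>i. i < n \<Longrightarrow> f i \<in> Hom C D X"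
  shows "\<exists>!h. h \<in> Hom C D (Xp n) \<and> (\<forall>i<n. Comp C (pr n i) h = f i)"
  using power[of n] assms unfolding is_power_def by blast

definition tuple :: "nat \<Rightarrow> 'o \<Rightarrow> (nat \<Rightarrow> 'm) \<Rightarrow> 'm" where
  "tuple n D f = (THE h. h \<in> Hom C D (Xp n) \<and> (\<forall>i<n. Comp C (pr n i) h = f i))"

lemma
  assumes "D \<in> Obj C" and "\<And>i. i < n \<Longrightarrow> f i \<in> Hom C D X"
  shows tuple_hom: "tuple n D f \<in> Hom C D (Xp n)"
    and pr_tuple: "i < n \<Longrightarrow> Comp C (pr n i) (tuple n D f) = f i"
proof -
  have "tuple n D f \<in> Hom C D (Xp n) \<and> (\<forall>i<n. Comp C (pr n i) (tuple n D f) = f i)"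
    unfolding tuple_def by (rule theI') (rule power_universal[OF assms])
  then show "tuple n D f \<in> Hom C D (Xp n)" and "i < n \<Longrightarrow> Comp C (pr n i) (tuple n D f) = f i"
    by blast+
qed

lemma power_hom_eqI:
  assumes "h \<in> Hom C D (Xp n)" and "k \<in> Hom C D (Xp n)"
    and "\<And>i. i < n \<Longrightarrow> Comp C (pr n i) h = Comp C (pr n i) k"
  shows "h = k"
  using power_universal[of D n "\<lambda>i. Comp C (pr n i) k"] assms hom_dom_obj comp_hom pr_hom
  by blast

text \<open>
  An arrow to \<open>X\<^sup>n\<^sup>+\<^sup>1\<close> amounts to \<open>n + 1\<close> arrows to \<open>X\<close>, and these to an arrow to \<open>X\<^sup>n\<close> and an
  arrow to \<open>X\<close>.
\<close>

lemma power_Suc_product: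
  "is_product C (Xp n) X (Xp (Suc n)) (tuple n (Xp (Suc n)) (pr (Suc n))) (pr (Suc n) n)"
proof -
  let ?P = "Xp (Suc n)"
  let ?t = "tuple n ?P (pr (Suc n))"
  have prS: "pr (Suc n) i \<in> Hom C ?P X" if "i < Suc n" for i
    using pr_hom that .
  have t: "?t \<in> Hom C ?P (Xp n)"
    using prS by (intro tuple_hom power_obj) simp
  have pr_t: "Comp C (pr n i) ?t = pr (Suc n) i" if "i < n" for i
    using prS that by (intro pr_tuple power_obj) simp_all
  have ex1: "\<exists>!h. h \<in> Hom C D ?P \<and> Comp C ?t h = f \<and> Comp C (pr (Suc n) n) h = g"
    if D: "D \<in> Obj C" and f: "f \<in> Hom C D (Xp n)" and g: "g \<in> Hom C D X" for D f g
  proof -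
    let ?F = "\<lambda>i. if i < n then Comp C (pr n i) f else g"
    have F: "?F i \<in> Hom C D X" for i
      using comp_hom[OF f pr_hom] g by simp
    have char: "Comp C ?t h = f \<longleftrightarrow> (\<forall>i<n. Comp C (pr (Suc n) i) h = ?F i)"
      if h: "h \<in> Hom C D ?P" for h
    proof -
      have th: "Comp C ?t h \<in> Hom C D (Xp n)"
        using comp_hom[OF h t] .
      have "Comp C (pr n i) (Comp C ?t h) = Comp C (pr (Suc n) i) h" if "i < n" for i
        using comp_assoc[OF h t pr_hom[OF that]] pr_t[OF that] by simp
      then show ?thesis using power_hom_eqI[OF th f] by auto
    qed
    have "(h \<in> Hom C D ?P \<and> Comp C ?t h = f \<and> Comp C (pr (Suc n) n) h = g) \<longleftrightarrow>
        (h \<in> Hom C D ?P \<and> (\<forall>i<Suc n. Comp C (pr (Suc n) i) h = ?F i))" for h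
      using char[of h] by (auto simp: less_Suc_eq)
    then show ?thesis using power_universal[OF D, of "Suc n" ?F] F by simp
  qed
  show ?thesis
    unfolding is_product_def using power_obj t prS ex1 by simp
qed

abbreviation comparison :: "nat \<Rightarrow> 'u \<Rightarrow> 'u list" where
  "comparison n \<equiv> power_comparison U n (pr n)"

lemma comparison_tuple:
  assumes "D \<in> Obj C" and f: "\<And>i. i < n \<Longrightarrow> f i \<in> Hom C D X" and z: "z \<in> UObj U D"
  shows "comparison n (UArr U (tuple n D f) z) = map (\<lambda>i. UArr U (f i) z) [0..<n]"
  unfolding power_comparison_def
proof (rule map_cong[OF refl])
  fix i assume "i \<in> set [0..<n]"
  then have i: "i < n" by simp
  show "UArr U (pr n i) (UArr U (tuple n D f) z) = UArr U (f i) z"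
    using map_comp[OF tuple_hom[of D n f, OF assms(1) f] pr_hom[OF i] z]
      pr_tuple[of D n f i, OF assms(1) f i] by simp
qed

text \<open>
  In the inductive step the comparison map for \<open>n + 1\<close> is the composite of three bijections: the
  binary comparison map \<open>U(X\<^sup>n\<^sup>+\<^sup>1) \<rightarrow> U(X\<^sup>n) \<times> U(X)\<close>, the comparison map for \<open>n\<close> on the first factor, and
  appending the last entry to a list.
\<close>

lemma comparison_bij:
  "bij_betw (comparison n) (UObj U (Xp n)) {xs. length xs = n \<and> set xs \<subseteq> UObj U X}"
proof (induction n)
  case 0
  have "terminal_object C (Xp 0)"
    using power[of 0] by (simp add: is_power_def terminal_object_def)
  then obtain x where "UObj U (Xp 0) = {x}"
    using preserves unfolding preserves_finite_products_def by blast
  then show ?case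
    by (auto simp: bij_betw_def power_comparison_def)
next
  case (Suc n)
  let ?P = "Xp (Suc n)"
  let ?t = "tuple n ?P (pr (Suc n))"
  let ?lists = "\<lambda>n. {xs. length xs = n \<and> set xs \<subseteq> UObj U X}"
  have 1: "bij_betw (\<lambda>z. (UArr U ?t z, UArr U (pr (Suc n) n) z))
      (UObj U ?P) (UObj U (Xp n) \<times> UObj U X)"
    using preserves power_Suc_product power_obj X_obj
    unfolding preserves_finite_products_def by blast
  have 2: "bij_betw (map_prod (comparison n) id)
      (UObj U (Xp n) \<times> UObj U X) (?lists n \<times> UObj U X)"
    using Suc by (intro bij_betw_map_prod) simp_all
  have 3: "bij_betw (\<lambda>(xs, x). xs @ [x]) (?lists n \<times> UObj U X) (?lists (Suc n))"
    by (rule bij_betw_byWitness[where f' = "\<lambda>xs. (butlast xs, last xs)"])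
      (force simp: length_Suc_conv_rev)+
  have "comparison (Suc n) z =
      ((\<lambda>(xs, x). xs @ [x]) \<circ> (map_prod (comparison n) id \<circ>
        (\<lambda>z. (UArr U ?t z, UArr U (pr (Suc n) n) z)))) z"
    if z: "z \<in> UObj U ?P" for z
    using comparison_tuple[OF power_obj _ z, of n "pr (Suc n)"] pr_hom[of _ "Suc n"]
    by (simp add: power_comparison_def)
  with bij_betw_trans[OF bij_betw_trans[OF 1 2] 3] show ?case
    using bij_betw_cong[of "UObj U ?P" "comparison (Suc n)"] by blast
qed

end


section \<open>Interpreting terms by arrows\<close>

locale power_algebra = product_preserving_functor_with_powers C U X Xp pr
  for C :: "('o, 'm) cat" and U :: "('o, 'm, 'u) setfun" and X Xp pr +
  fixes Sig :: "nat \<Rightarrow> 'f set" and c :: "nat \<Rightarrow> 'f \<Rightarrow> 'm"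
  assumes c_hom: "s \<in> Sig n \<Longrightarrow> c n s \<in> Hom C (Xp n) X"
begin

abbreviation ops :: "nat \<Rightarrow> 'f \<Rightarrow> 'u list \<Rightarrow> 'u" where
  "ops \<equiv> induced_operations U Xp pr c"

lemma ops_comparison:
  "z \<in> UObj U (Xp n) \<Longrightarrow> ops n s (comparison n z) = UArr U (c n s) z"
  unfolding induced_operations_def
  using the_inv_into_f_f[OF bij_betw_imp_inj_on[OF comparison_bij]] by metis

lemma cata_ground_carrier:
  "t \<in> ground_terms Sig \<Longrightarrow> cata ops t \<in> UObj U X"
proof (induction rule: terms.induct)
  case (Fun s ts)
  obtain z where z: "z \<in> UObj U (Xp (length ts))"
      and "map (cata ops) ts = comparison (length ts) z"
    using Fun.IH bij_betw_imp_surj_on[OF comparison_bij[of "length ts"]]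
    by (force simp: set_eq_iff image_iff)
  then have "cata ops (Fun s ts) = UArr U (c (length ts) s) z"
    by (simp add: ops_comparison)
  with map_arr[OF c_hom[OF Fun.hyps(1)]] z show ?case by auto
qed simp

text \<open>The function \<open>ix\<close> assigns to each variable its coordinate in \<open>X\<^sup>d\<close>.\<close>

primrec term_arrow :: "nat \<Rightarrow> ('v \<Rightarrow> nat) \<Rightarrow> ('f, 'v) trm \<Rightarrow> 'm" where
  "term_arrow d ix (Var v) = pr d (ix v)"
| "term_arrow d ix (Fun s ts) = Comp C (c (length ts) s)
     (tuple (length ts) (Xp d) ((!) (map (term_arrow d ix) ts)))"

lemma term_arrow_hom:
  assumes "t \<in> terms Sig W" and "\<And>v. v \<in> W \<Longrightarrow> ix v < d"
  shows "term_arrow d ix t \<in> Hom C (Xp d) X"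
  using assms(1)
proof (induction rule: terms.induct)
  case (Var v)
  then show ?case using pr_hom assms(2) by simp
next
  case (Fun s ts)
  have "tuple (length ts) (Xp d) ((!) (map (term_arrow d ix) ts)) \<in> Hom C (Xp d) (Xp (length ts))"
    using Fun.IH by (intro tuple_hom power_obj) simp
  then show ?case using comp_hom c_hom[OF Fun.hyps(1)] by simp
qed

text \<open>
  If the point \<open>z\<close> of \<open>U(X\<^sup>d)\<close> lists the values of the terms \<open>\<sigma>(v)\<close>, then applying \<open>U\<close> of the
  interpretation of \<open>t\<close> to \<open>z\<close> evaluates \<open>\<sigma>(t)\<close>: both sides are compatible with the operators, because \<open>U\<close> of a
  tupling is the tupling of the images up to the comparison map.
\<close>

lemma map_term_arrow:
  assumes "t \<in> terms Sig W" and ix: "\<And>v. v \<in> W \<Longrightarrow> ix v < d"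
    and z: "z \<in> UObj U (Xp d)"
    and z_vals: "\<And>v. v \<in> W \<Longrightarrow> UArr U (pr d (ix v)) z = cata ops (\<sigma> v)"
  shows "UArr U (term_arrow d ix t) z = cata ops (subst \<sigma> t)"
  using assms(1)
proof (induction rule: terms.induct)
  case (Var v)
  then show ?case using z_vals by simp
next
  case (Fun s ts)
  let ?fs = "(!) (map (term_arrow d ix) ts)"
  let ?h = "tuple (length ts) (Xp d) ?fs"
  have fs: "?fs i \<in> Hom C (Xp d) X" if "i < length ts" for i
    using term_arrow_hom[OF Fun.hyps(2) ix] that by simp
  have h: "?h \<in> Hom C (Xp d) (Xp (length ts))"
    using tuple_hom[OF power_obj fs] .
  have "comparison (length ts) (UArr U ?h z) = map (\<lambda>i. UArr U (?fs i) z) [0..<length ts]"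
    using comparison_tuple[OF power_obj fs z] .
  also have "\<dots> = map (cata ops) (map (subst \<sigma>) ts)"
    using Fun.IH by (intro nth_equalityI) simp_all
  finally have "cata ops (subst \<sigma> (Fun s ts)) = UArr U (c (length ts) s) (UArr U ?h z)"
    using ops_comparison[of "UArr U ?h z" "length ts" s] map_arr[OF h] z by auto
  also have "\<dots> = UArr U (term_arrow d ix (Fun s ts)) z"
    using map_comp[OF h c_hom[OF Fun.hyps(1)] z] by simp
  finally show ?case ..
qed

end


section \<open>The equivalent dynamical system\<close>

theorem theorem7p1:
  fixes C :: "('o, 'm) cat" and U :: "('o, 'm, 'u) setfun"
    and Sig :: "nat \<Rightarrow> 'f set"
    and X :: 'o and Xp :: "nat \<Rightarrow> 'o" and pr :: "nat \<Rightarrow> nat \<Rightarrow> 'm"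
    and c :: "nat \<Rightarrow> 'f \<Rightarrow> 'm"
    and V :: "'v set" and l r t0 :: "('f, 'v) trm" and p :: "nat list"
  assumes "category C"
    and "has_finite_products C"
    and "has_finite_coproducts C"
    and "set_functor C U"
    and "preserves_finite_products C U"
    and "preserves_finite_coproducts C U"
    and "X \<in> Obj C"
    and "\<And>n. is_power C X n (Xp n) (pr n)"
    and "\<And>n s. s \<in> Sig n \<Longrightarrow> c n s \<in> Hom C (Xp n) X"
    and "rewriting_model Sig V l r p t0"
  shows "\<exists>d G f x0. G \<in> Hom C (Xp d) (Xp d) \<and> f \<in> Hom C (Xp d) X \<and> x0 \<in> UObj U (Xp d) \<and>
    rewriting_sequence Sig (induced_operations U Xp pr c) V l r p t0 =
      dynamical_sequence (UArr U G) (UArr U f) x0"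
proof -
  interpret power_algebra C U X Xp pr Sig c
    using assms by (intro power_algebra.intro product_preserving_functor_with_powers.intro
        product_preserving_functor_with_powers_axioms.intro power_algebra_axioms.intro) auto
  obtain \<tau> where ident: "sig_identity Sig V l (subst \<tau> l)"
      and \<tau>: "\<tau> \<in> substitutions Sig V" and r: "r = subst \<tau> l"
    using assms(10) unfolding rewriting_model_def by blast
  obtain \<sigma> where t0: "t0 \<in> ground_terms Sig" and p: "p \<in> positions t0"
      and \<sigma>: "\<sigma> \<in> substitutions Sig V" and match: "subterm_at t0 p = subst \<sigma> l"
    using assms(10) unfolding rewriting_model_def instances_at_def by blast
  define W where "W = vars l"
  have l: "l \<in> terms Sig W"
    using ident unfolding sig_identity_def W_def by (auto intro: terms_restrict_vars)
  have W: "W \<subseteq> V"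
    using ident terms_iff_vars[of l Sig V] unfolding sig_identity_def W_def by blast
  have vars_t0: "vars t0 = {}"
    using t0 terms_iff_vars[of t0 Sig "{}"] by blast
  have \<tau>W: "\<tau> v \<in> terms Sig W" if "v \<in> W" for v
  proof (rule terms_restrict_vars)
    show "\<tau> v \<in> terms Sig V" using \<tau> W that unfolding substitutions_def by blast
    show "vars (\<tau> v) \<subseteq> W"
      using ident that vars_subst[of \<tau> l] unfolding sig_identity_def W_def by blast
  qed
  have \<sigma>W: "\<sigma> v \<in> ground_terms Sig" if "v \<in> W" for v
  proof (rule terms_restrict_vars)
    show "\<sigma> v \<in> terms Sig V" using \<sigma> W that unfolding substitutions_def by blast
    have "vars (subst \<sigma> l) = {}"
      using vars_subterm_at[OF p] match vars_t0 by simp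
    then show "vars (\<sigma> v) \<subseteq> {}"
      using that vars_subst[of \<sigma> l] unfolding W_def by blast
  qed
  define \<sigma>s where "\<sigma>s n = ((\<lambda>\<rho> v. subst \<rho> (\<tau> v)) ^^ n) \<sigma>" for n
  define s where "s = replace_at t0 p l"
  have s: "s \<in> terms Sig W"
    using replace_at_terms[OF p _ l] terms_restrict_vars[OF t0, of W] vars_t0
    unfolding s_def by simp
  have iterate: "(rewrite Sig V l r p ^^ n) t0 = subst (\<sigma>s n) s" for n
    using rewrite_iterate[OF ident \<tau> \<sigma> p match] subst_replace_at_ground[OF p vars_t0]
    unfolding r s_def \<sigma>s_def by simp
  define d where "d = card W"
  obtain ix where ix: "bij_betw ix W {0..<d}"
    using ex_bij_betw_finite_nat[of W] finite_vars[of l] unfolding d_def W_def by blast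
  have ix_less: "ix v < d" if "v \<in> W" for v
    using bij_betwE[OF ix] that by simp
  define var where "var = inv_into W ix"
  have var_ix: "var (ix v) = v" if "v \<in> W" for v
    using ix that by (simp add: var_def bij_betw_inv_into_left)
  have var_W: "var i \<in> W" if "i < d" for i
    using bij_betw_apply[OF bij_betw_inv_into[OF ix]] that by (simp add: var_def)
  define G where "G = tuple d (Xp d) (\<lambda>i. term_arrow d ix (\<tau> (var i)))"
  define f where "f = term_arrow d ix s"
  have \<tau>_hom: "term_arrow d ix (\<tau> (var i)) \<in> Hom C (Xp d) X" if "i < d" for i
    using term_arrow_hom[OF \<tau>W[OF var_W[OF that]]] ix_less by blast
  have G: "G \<in> Hom C (Xp d) (Xp d)"
    unfolding G_def using tuple_hom[OF power_obj \<tau>_hom] .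
  have f: "f \<in> Hom C (Xp d) X"
    unfolding f_def using term_arrow_hom[OF s] ix_less by blast
  have "map (\<lambda>i. cata ops (\<sigma> (var i))) [0..<d] \<in> {xs. length xs = d \<and> set xs \<subseteq> UObj U X}"
    by (auto intro!: cata_ground_carrier \<sigma>W var_W)
  then obtain x0 where x0: "x0 \<in> UObj U (Xp d)"
      and "comparison d x0 = map (\<lambda>i. cata ops (\<sigma> (var i))) [0..<d]"
    using bij_betw_imp_surj_on[OF comparison_bij[of d]] by (metis (no_types, lifting) imageE)
  then have start: "UArr U (pr d i) x0 = cata ops (\<sigma> (var i))" if "i < d" for i
    using that by (simp add: power_comparison_def)
  \<comment> \<open>Coordinate \<open>v\<close> of \<open>G\<close> evaluates \<open>\<tau>(v)\<close>, which matches \<open>\<sigma>\<^sub>n\<^sub>+\<^sub>1(v) = \<sigma>\<^sub>n(\<tau>(v))\<close>.\<close>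
  have state: "(UArr U G ^^ n) x0 \<in> UObj U (Xp d) \<and>
      (\<forall>v\<in>W. UArr U (pr d (ix v)) ((UArr U G ^^ n) x0) = cata ops (\<sigma>s n v))" for n
  proof (induction n)
    case 0
    show ?case using x0 start ix_less var_ix by (simp add: \<sigma>s_def)
  next
    case (Suc n)
    let ?z = "(UArr U G ^^ n) x0"
    have z: "?z \<in> UObj U (Xp d)" using Suc by blast
    have "UArr U (pr d (ix v)) (UArr U G ?z) = cata ops (\<sigma>s (Suc n) v)" if v: "v \<in> W" for v
    proof -
      have "UArr U (pr d (ix v)) (UArr U G ?z) = UArr U (Comp C (pr d (ix v)) G) ?z"
        using map_comp[OF G pr_hom[OF ix_less[OF v]] z] by simp
      also have "Comp C (pr d (ix v)) G = term_arrow d ix (\<tau> v)"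
        unfolding G_def using pr_tuple[OF power_obj \<tau>_hom ix_less[OF v]] var_ix[OF v] by simp
      also have "UArr U (term_arrow d ix (\<tau> v)) ?z = cata ops (subst (\<sigma>s n) (\<tau> v))"
        using map_term_arrow[where ix = ix, OF \<tau>W[OF v] ix_less z] Suc by blast
      finally show ?thesis by (simp add: \<sigma>s_def)
    qed
    then show ?case using map_arr[OF G] z by auto
  qed
  have "rewriting_sequence Sig ops V l r p t0 n = dynamical_sequence (UArr U G) (UArr U f) x0 n"
    for n
    unfolding rewriting_sequence_def dynamical_sequence_def iterate f_def
    using map_term_arrow[where ix = ix, OF s ix_less] state[of n] by metis
  with G f x0 show ?thesis by blast
qed

end
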